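(* Let $A$ be a finite alphabet, let $M_A$ be the free inverse monoid on $A$, and let $\varphi$ be a monoid endomorphism of $M_A$. Then the submonoid $\mathrm{Per}(\varphi)$ of periodic points of $\varphi$ is finitely generated.
   Context: Let $A^{-1}$ be a set of formal inverses of $A$, $\widetilde{A}=A\cup A^{-1}$, and extend $a\mapsto a^{-1}$ to an involution on the free monoid $\widetilde{A}^*$ by $1^{-1}=1$, $(a^{-1})^{-1}=a$, $(uv)^{-1}=v^{-1}u^{-1}$. The free inverse monoid $M_A$ is the quotient of $\widetilde{A}^*$ by the congruence generated by $\{(uu^{-1}u,u)\mid u\in\widetilde{A}^*\}\cup\{(uu^{-1}vv^{-1},vv^{-1}uu^{-1})\mid u,v\in\widetilde{A}^*\}$. Maps are written on the right of their arguments. For an endomorphism $\psi$ of a monoid $M$, $\mathrm{Fix}(\psi)=\{x\in M: x\psi=x\}$ and $\mathrm{Per}(\psi)=\bigcup_{n\ge 1}\mathrm{Fix}(\psi^n)$; both are submonoids of $M$ (and inverse submonoids when $M$ is inverse). *)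

theory Defs
  imports "HOL-Algebra.Group"
begin

section \<open>Congruences, quotients and generation in monoids\<close>

definition monoid_congruence :: "('a, 'b) monoid_scheme \<Rightarrow> ('a \<times> 'a) set \<Rightarrow> bool" where
  "monoid_congruence G r \<longleftrightarrow> equiv (carrier G) r \<and>
     (\<forall>x y u v. (x, y) \<in> r \<longrightarrow> (u, v) \<in> r \<longrightarrow> (x \<otimes>\<^bsub>G\<^esub> u, y \<otimes>\<^bsub>G\<^esub> v) \<in> r)"

definition congruence_generated ::
    "('a, 'b) monoid_scheme \<Rightarrow> ('a \<times> 'a) set \<Rightarrow> ('a \<times> 'a) set" where
  "congruence_generated G R = \<Inter>{r. monoid_congruence G r \<and> R \<subseteq> r}"

text \<open>The union in the product of two classes is a single class whenever \<open>r\<close> is a congruence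
  (see \<open>quotient_monoid_mult_class\<close> below).\<close>

definition quotient_monoid :: "('a, 'b) monoid_scheme \<Rightarrow> ('a \<times> 'a) set \<Rightarrow> 'a set monoid" where
  "quotient_monoid G r =
     \<lparr>carrier = carrier G // r,
      mult = (\<lambda>X Y. \<Union>x\<in>X. \<Union>y\<in>Y. r `` {x \<otimes>\<^bsub>G\<^esub> y}),
      one = r `` {\<one>\<^bsub>G\<^esub>}\<rparr>"

definition submonoid_generated :: "('a, 'b) monoid_scheme \<Rightarrow> 'a set \<Rightarrow> 'a set" where
  "submonoid_generated G S = \<Inter>{H. submonoid H G \<and> S \<subseteq> H}"

definition finitely_generated_submonoid :: "('a, 'b) monoid_scheme \<Rightarrow> 'a set \<Rightarrow> bool" where
  "finitely_generated_submonoid G H \<longleftrightarrow>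
     submonoid H G \<and> (\<exists>S. finite S \<and> S \<subseteq> H \<and> submonoid_generated G S = H)"

text \<open>\<^const>\<open>hom\<close> alone does not require that the unit is preserved.\<close>

definition monoid_endomorphisms :: "('a, 'b) monoid_scheme \<Rightarrow> ('a \<Rightarrow> 'a) set" where
  "monoid_endomorphisms G = {f \<in> hom G G. f \<one>\<^bsub>G\<^esub> = \<one>\<^bsub>G\<^esub>}"

definition Fix :: "('a, 'b) monoid_scheme \<Rightarrow> ('a \<Rightarrow> 'a) \<Rightarrow> 'a set" where
  "Fix G f = {x \<in> carrier G. f x = x}"

definition Per :: "('a, 'b) monoid_scheme \<Rightarrow> ('a \<Rightarrow> 'a) \<Rightarrow> 'a set" where
  "Per G f = (\<Union>n\<in>{1..}. Fix G (f ^^ n))"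


section \<open>The free inverse monoid\<close>

definition free_monoid :: "'a set \<Rightarrow> 'a list monoid" where
  "free_monoid X = \<lparr>carrier = lists X, mult = (@), one = []\<rparr>"

datatype 'a letter = Pos 'a | Neg 'a

definition signed_alphabet :: "'a set \<Rightarrow> 'a letter set" where
  "signed_alphabet A = Pos ` A \<union> Neg ` A"

primrec letter_inv :: "'a letter \<Rightarrow> 'a letter" where
  "letter_inv (Pos a) = Neg a"
| "letter_inv (Neg a) = Pos a"

definition word_inv :: "'a letter list \<Rightarrow> 'a letter list" where
  "word_inv w = rev (map letter_inv w)"

definition free_inverse_relators :: "'a set \<Rightarrow> ('a letter list \<times> 'a letter list) set" where
  "free_inverse_relators A =
     {(u @ word_inv u @ u, u) | u. u \<in> lists (signed_alphabet A)} \<union>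
     {(u @ word_inv u @ v @ word_inv v, v @ word_inv v @ u @ word_inv u) | u v.
        u \<in> lists (signed_alphabet A) \<and> v \<in> lists (signed_alphabet A)}"

definition free_inverse_monoid :: "'a set \<Rightarrow> 'a letter list set monoid" where
  "free_inverse_monoid A =
     quotient_monoid (free_monoid (signed_alphabet A))
       (congruence_generated (free_monoid (signed_alphabet A)) (free_inverse_relators A))"


section \<open>Well-definedness\<close>

lemma monoid_free_monoid: "monoid (free_monoid X)"
  by (rule monoidI) (auto simp: free_monoid_def)

lemma letter_inv_letter_inv [simp]: "letter_inv (letter_inv x) = x"
  by (cases x) auto

lemma word_inv_simps [simp]:
  "word_inv [] = []"
  "word_inv (u @ v) = word_inv v @ word_inv u"
  "word_inv (word_inv w) = w"
  by (simp_all add: word_inv_def rev_map comp_def)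

lemma word_inv_closed:
  assumes "u \<in> lists (signed_alphabet A)"
  shows "word_inv u \<in> lists (signed_alphabet A)"
proof -
  have "letter_inv x \<in> signed_alphabet A" if "x \<in> signed_alphabet A" for x
    using that by (auto simp: signed_alphabet_def)
  with assms show ?thesis by (auto simp: word_inv_def)
qed

lemma free_inverse_relators_closed:
  "free_inverse_relators A \<subseteq> lists (signed_alphabet A) \<times> lists (signed_alphabet A)"
  using word_inv_closed unfolding free_inverse_relators_def by fastforce

lemma monoid_congruence_generated:
  assumes "monoid G" and R: "R \<subseteq> carrier G \<times> carrier G"
  shows "monoid_congruence G (congruence_generated G R)"
proof -
  interpret monoid G by fact
  let ?C = "{r. monoid_congruence G r \<and> R \<subseteq> r}"
  have "carrier G \<times> carrier G \<in> ?C"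
    using R by (auto simp: monoid_congruence_def intro!: equivI refl_onI symI transI)
  then have "\<Inter>?C \<subseteq> carrier G \<times> carrier G" by blast
  moreover have "refl_on (carrier G) (\<Inter>?C)"
    by (auto simp: monoid_congruence_def equiv_def refl_on_def)
  moreover have "sym (\<Inter>?C)"
    by (rule symI) (auto simp: monoid_congruence_def equiv_def elim: symE)
  moreover have "trans (\<Inter>?C)"
    by (rule transI) (auto simp: monoid_congruence_def equiv_def dest: transD)
  ultimately have "equiv (carrier G) (\<Inter>?C)" by (rule equivI)
  then show ?thesis
    unfolding congruence_generated_def by (auto simp: monoid_congruence_def)
qed

lemma quotient_monoid_mult_class:
  assumes "monoid_congruence G r" and "x \<in> carrier G" and "y \<in> carrier G"
  shows "r `` {x} \<otimes>\<^bsub>quotient_monoid G r\<^esub> r `` {y} = r `` {x \<otimes>\<^bsub>G\<^esub> y}"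
proof -
  have e: "equiv (carrier G) r" using assms by (simp add: monoid_congruence_def)
  have "congruent2 r r (\<lambda>x y. r `` {x \<otimes>\<^bsub>G\<^esub> y})"
    using assms(1) e
    by (auto simp: monoid_congruence_def congruent2_def intro!: equiv_class_eq[OF e])
  from UN_equiv_class2[OF e e this assms(2,3)] show ?thesis
    by (simp add: quotient_monoid_def)
qed

lemma monoid_quotient_monoid:
  assumes "monoid G" and c: "monoid_congruence G r"
  shows "monoid (quotient_monoid G r)"
proof -
  interpret monoid G by fact
  let ?Q = "quotient_monoid G r"
  have car: "carrier ?Q = carrier G // r" and one: "\<one>\<^bsub>?Q\<^esub> = r `` {\<one>\<^bsub>G\<^esub>}"
    by (simp_all add: quotient_monoid_def)
  show ?thesis
    by (rule monoidI)
      (auto simp: car one quotient_monoid_mult_class[OF c] m_assoc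
            intro!: quotientI elim!: quotientE)
qed

lemma monoid_free_inverse_monoid: "monoid (free_inverse_monoid A)"
  unfolding free_inverse_monoid_def
  by (intro monoid_quotient_monoid monoid_congruence_generated monoid_free_monoid)
    (use free_inverse_relators_closed in \<open>simp add: free_monoid_def\<close>)

lemma funpow_monoid_endomorphism:
  assumes "monoid G" and "f \<in> monoid_endomorphisms G"
  shows "f ^^ n \<in> monoid_endomorphisms G"
  using assms(2)
  by (induction n) (auto simp: monoid_endomorphisms_def hom_def Pi_def)

lemma submonoid_Per:
  assumes "monoid G" and f: "f \<in> monoid_endomorphisms G"
  shows "submonoid (Per G f) G"
proof -
  interpret monoid G by fact
  have iter: "(f ^^ (n * k)) x = x" if "(f ^^ n) x = x" for n k x
    using that by (induction k) (simp_all add: funpow_add)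
  show ?thesis
  proof
    show "Per G f \<subseteq> carrier G" by (auto simp: Per_def Fix_def)
    show "\<one>\<^bsub>G\<^esub> \<in> Per G f"
      using f by (auto simp: Per_def Fix_def monoid_endomorphisms_def intro!: bexI[of _ 1])
    fix x y assume "x \<in> Per G f" "y \<in> Per G f"
    then obtain m n where mn: "m \<ge> 1" "n \<ge> 1" "x \<in> carrier G" "y \<in> carrier G"
      "(f ^^ m) x = x" "(f ^^ n) y = y" by (auto simp: Per_def Fix_def)
    have "(f ^^ (m * n)) x = x" "(f ^^ (m * n)) y = y"
      using iter[OF mn(5), of n] iter[OF mn(6), of m] by (simp_all add: mult.commute)
    moreover have "f ^^ (m * n) \<in> hom G G"
      using funpow_monoid_endomorphism[OF assms] by (simp add: monoid_endomorphisms_def)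
    ultimately have "(f ^^ (m * n)) (x \<otimes>\<^bsub>G\<^esub> y) = x \<otimes>\<^bsub>G\<^esub> y"
      using mn by (simp add: hom_def)
    then show "x \<otimes>\<^bsub>G\<^esub> y \<in> Per G f"
      using mn by (auto simp: Per_def Fix_def intro!: bexI[of _ "m * n"])
  qed
qed

end

theory Submission
  imports Defs
begin

text \<open>The theorem rests on one property of the free inverse monoid \<open>M\<close>: every element has only
  finitely many two-sided factors (\<open>finite_factors_free_inverse_monoid\<close>). Let \<open>x\<close> be fixed by
  \<open>f\<^sup>m\<close> and write \<open>x\<close> as a product of letters. Each letter \<open>s\<close> occurring in it is a factor of \<open>x\<close>,
  hence each \<open>f\<^sup>m\<^sup>j(s)\<close> is a factor of \<open>f\<^sup>m\<^sup>j(x) = x\<close>. The orbit of \<open>s\<close> is therefore finite. As there are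
  finitely many letters, a single exponent \<open>N\<close> satisfies \<open>f\<^sup>2\<^sup>N(s) = f\<^sup>N(s)\<close> for all letters \<open>s\<close> of finite
  orbit. Applying \<open>f\<^sup>m\<^sup>N\<close> to the product shows that \<open>x\<close> is a product of the elements \<open>f\<^sup>N(s)\<close>, and these
  are themselves periodic. So the finitely many elements \<open>f\<^sup>N(s)\<close> generate the periodic points. This
  argument works in every finitely generated monoid with finite factor sets
  (\<open>finitely_generated_Per\<close>).

  Finiteness of factor sets comes from Munn trees. Words act on the vertices of the Cayley tree of the
  free group, that is, on reduced words. For every starting vertex, the endpoint of the path
  described by a word and the set of vertices that it visits depend only on the class of the word
  in \<open>M\<close> (\<open>word_class_invariant\<close>). A factor of the class of \<open>w\<close> is thus represented by a word whose path,
  from a suitable start, stays among the finitely many vertices visited by \<open>w\<close>. In the other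
  direction, a class is determined by an enumeration of the visited vertices together with the endpoint
  (\<open>word_class_normal_form\<close>), so a finite set of vertices supports only finitely many classes.\<close>

section \<open>Periodic points in monoids whose elements have few factors\<close>

definition factors :: "('a, 'b) monoid_scheme \<Rightarrow> 'a \<Rightarrow> 'a set" where
  "factors G x = {y \<in> carrier G. \<exists>u\<in>carrier G. \<exists>v\<in>carrier G. x = u \<otimes>\<^bsub>G\<^esub> y \<otimes>\<^bsub>G\<^esub> v}"

lemma funpow_mult_fixed:
  fixes f :: "'a \<Rightarrow> 'a"
  assumes "(f ^^ n) x = x"
  shows "(f ^^ (n * k)) x = x"
  using assms by (induction k) (simp_all add: funpow_add)

lemma funpow_idem_mult:
  fixes f :: "'a \<Rightarrow> 'a"
  assumes "(f ^^ (2 * k)) x = (f ^^ k) x" and "j \<ge> 1"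
  shows "(f ^^ (j * k)) x = (f ^^ k) x"
proof -
  have "(f ^^ k) ((f ^^ k) x) = (f ^^ k) x"
    using assms(1) by (simp add: mult_2 funpow_add)
  then have "(f ^^ (k * (j - 1))) ((f ^^ k) x) = (f ^^ k) x"
    by (rule funpow_mult_fixed)
  moreover have "j * k = k * (j - 1) + k"
    using assms(2) by (cases j) (simp_all add: algebra_simps)
  ultimately show ?thesis by (simp add: funpow_add)
qed

text \<open>On a finite orbit some positive iterate of \<open>f\<close> is idempotent. Unlike a preperiod and a
  period, this is a single number, and it may be multiplied freely (\<open>funpow_idem_mult\<close>); this is what
  makes a common exponent for several orbits easy to find.\<close>

lemma finite_orbit_idem_power:
  fixes f :: "'a \<Rightarrow> 'a"
  assumes "finite (range (\<lambda>j. (f ^^ j) x))"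
  shows "\<exists>k\<ge>1. (f ^^ (2 * k)) x = (f ^^ k) x"
proof -
  have "\<not> inj (\<lambda>j. (f ^^ j) x)"
    using assms finite_imageD by blast
  then obtain i j where ij: "i < j" "(f ^^ i) x = (f ^^ j) x"
    unfolding inj_def by (metis linorder_neqE_nat)
  define d where "d = j - i"
  have "(f ^^ (d + i)) x = (f ^^ i) x" and "d \<ge> 1"
    using ij by (simp_all add: d_def)
  then have d: "d \<ge> 1" "(f ^^ d) ((f ^^ i) x) = (f ^^ i) x"
    by (simp_all add: funpow_add)
  \<comment> \<open>any multiple of the period \<open>d\<close> that is at least the preperiod \<open>i\<close> will do\<close>
  define k where "k = d * (i + 1)"
  have "1 * (i + 1) \<le> d * (i + 1)" using d(1) by (rule mult_le_mono1)
  then have "k \<ge> i + 1" by (simp add: k_def)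
  then obtain r where r: "k = r + i" by (metis add.commute le_add1 le_Suc_ex order_trans)
  have "(f ^^ k) ((f ^^ i) x) = (f ^^ i) x"
    unfolding k_def using d(2) by (rule funpow_mult_fixed)
  then have "(f ^^ (k + i)) x = (f ^^ i) x"
    by (simp add: funpow_add)
  then have "(f ^^ (r + (k + i))) x = (f ^^ (r + i)) x"
    by (simp only: funpow_add comp_apply)
  then have "(f ^^ (2 * k)) x = (f ^^ k) x"
    by (simp add: r mult_2_right ac_simps)
  then show ?thesis using \<open>k \<ge> i + 1\<close> by (intro exI[of _ k]) simp
qed

lemma submonoid_submonoid_generated:
  assumes "monoid G" and "S \<subseteq> carrier G"
  shows "submonoid (submonoid_generated G S) G"
proof -
  interpret monoid G by fact
  have "submonoid (carrier G) G" by unfold_locales auto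
  then have "submonoid_generated G S \<subseteq> carrier G"
    using assms(2) by (auto simp: submonoid_generated_def)
  then show ?thesis
    by unfold_locales (auto simp: submonoid_generated_def submonoid_def)
qed

lemma submonoid_generated_incl: "S \<subseteq> submonoid_generated G S"
  by (auto simp: submonoid_generated_def)

lemma submonoid_generated_least:
  "submonoid H G \<Longrightarrow> S \<subseteq> H \<Longrightarrow> submonoid_generated G S \<subseteq> H"
  by (auto simp: submonoid_generated_def)

lemma submonoid_generated_mono:
  "S \<subseteq> T \<Longrightarrow> submonoid_generated G S \<subseteq> submonoid_generated G T"
  by (auto simp: submonoid_generated_def)

lemma image_submonoid_generated:
  assumes "monoid G" and f: "f \<in> monoid_endomorphisms G" and S: "S \<subseteq> carrier G"
  shows "f ` submonoid_generated G S \<subseteq> submonoid_generated G (f ` S)"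
proof -
  interpret monoid G by fact
  have fc: "f x \<in> carrier G" if "x \<in> carrier G" for x
    using f that by (auto simp: monoid_endomorphisms_def hom_def)
  interpret T: submonoid "submonoid_generated G (f ` S)" G
    by (rule submonoid_submonoid_generated) (use fc S in \<open>auto intro: monoid_axioms\<close>)
  have "submonoid {x \<in> carrier G. f x \<in> submonoid_generated G (f ` S)} G"
    using f by unfold_locales (auto simp: monoid_endomorphisms_def hom_def)
  then have "submonoid_generated G S \<subseteq> {x \<in> carrier G. f x \<in> submonoid_generated G (f ` S)}"
    using S submonoid_generated_incl[of "f ` S" G] by (intro submonoid_generated_least) auto
  then show ?thesis by auto
qed

text \<open>The elements that satisfy this form a submonoid containing \<open>S\<close>, because the factors of \<open>y\<close> and
  those of \<open>z\<close> are factors of \<open>y \<otimes> z\<close>.\<close>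

lemma generated_by_factors:
  fixes G (structure)
  assumes "monoid G" and S: "S \<subseteq> carrier G"
    and gen: "submonoid_generated G S = carrier G" and x: "x \<in> carrier G"
  shows "x \<in> submonoid_generated G (S \<inter> factors G x)"
proof -
  interpret monoid G by fact
  let ?H = "{x \<in> carrier G. x \<in> submonoid_generated G (S \<inter> factors G x)}"
  have sub: "submonoid (submonoid_generated G (S \<inter> T)) G" for T
    using S by (intro submonoid_submonoid_generated monoid_axioms) auto
  have "submonoid ?H G"
  proof
    show "?H \<subseteq> carrier G" by auto
    show "\<one> \<in> ?H" using sub by (auto simp: submonoid_def)
    fix y z assume yz: "y \<in> ?H" "z \<in> ?H"
    have "factors G y \<subseteq> factors G (y \<otimes> z)"
    proof
      fix s assume "s \<in> factors G y"
      then obtain u v where "s \<in> carrier G" "u \<in> carrier G" "v \<in> carrier G" "y = u \<otimes> s \<otimes> v"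
        by (auto simp: factors_def)
      then show "s \<in> factors G (y \<otimes> z)"
        unfolding factors_def using yz
        by (intro CollectI conjI bexI[of _ u] bexI[of _ "v \<otimes> z"]) (simp_all add: m_assoc)
    qed
    moreover have "factors G z \<subseteq> factors G (y \<otimes> z)"
    proof
      fix s assume "s \<in> factors G z"
      then obtain u v where "s \<in> carrier G" "u \<in> carrier G" "v \<in> carrier G" "z = u \<otimes> s \<otimes> v"
        by (auto simp: factors_def)
      then show "s \<in> factors G (y \<otimes> z)"
        unfolding factors_def using yz
        by (intro CollectI conjI bexI[of _ "y \<otimes> u"] bexI[of _ v]) (simp_all add: m_assoc)
    qed
    ultimately have "submonoid_generated G (S \<inter> factors G y) \<subseteq> submonoid_generated G (S \<inter> factors G (y \<otimes> z))"
      "submonoid_generated G (S \<inter> factors G z) \<subseteq> submonoid_generated G (S \<inter> factors G (y \<otimes> z))"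
      by (intro submonoid_generated_mono Int_mono order_refl; simp)+
    then have "y \<in> submonoid_generated G (S \<inter> factors G (y \<otimes> z))"
      "z \<in> submonoid_generated G (S \<inter> factors G (y \<otimes> z))"
      using yz by auto
    then show "y \<otimes> z \<in> ?H"
      using yz sub by (auto simp: submonoid_def)
  qed
  moreover have "S \<subseteq> ?H"
  proof
    fix s assume s: "s \<in> S"
    then have "s \<in> factors G s"
      using S by (auto simp: factors_def intro!: bexI[of _ \<one>])
    then show "s \<in> ?H"
      using s S submonoid_generated_incl[of "S \<inter> factors G s" G] by auto
  qed
  ultimately show ?thesis
    using submonoid_generated_least[of ?H G S] gen x by auto
qed

text \<open>If \<open>f ^^ m\<close> fixes \<open>x\<close>, all its iterates send factors of \<open>x\<close> to factors of \<open>x\<close>; so a factor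
  moves within a finite set.\<close>

lemma factor_of_periodic_idem_power:
  fixes G (structure)
  assumes "monoid G" and f: "f \<in> monoid_endomorphisms G"
    and fin: "finite (factors G x)" and x: "x \<in> Per G f" and s: "s \<in> factors G x"
  shows "\<exists>k\<ge>1. (f ^^ (2 * k)) s = (f ^^ k) s"
proof -
  interpret monoid G by fact
  obtain m where m: "m \<ge> 1" "(f ^^ m) x = x"
    using x by (auto simp: Per_def Fix_def)
  obtain u v where uv: "s \<in> carrier G" "u \<in> carrier G" "v \<in> carrier G" "x = u \<otimes> s \<otimes> v"
    using s by (auto simp: factors_def)
  have "((f ^^ m) ^^ j) s \<in> factors G x" for j
  proof -
    let ?g = "(f ^^ m) ^^ j"
    have "?g \<in> monoid_endomorphisms G"
      by (intro funpow_monoid_endomorphism f monoid_axioms)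
    moreover have "?g x = x" using funpow_mult_fixed[OF m(2)] by (simp add: funpow_mult)
    ultimately have "x = ?g u \<otimes> ?g s \<otimes> ?g v" "?g u \<in> carrier G" "?g s \<in> carrier G" "?g v \<in> carrier G"
      using uv by (auto simp: monoid_endomorphisms_def hom_def Pi_def)
    then show ?thesis by (auto simp: factors_def)
  qed
  then have "finite (range (\<lambda>j. ((f ^^ m) ^^ j) s))"
    using fin by (auto intro: finite_subset)
  from finite_orbit_idem_power[OF this] obtain k
    where k: "k \<ge> 1" "((f ^^ m) ^^ (2 * k)) s = ((f ^^ m) ^^ k) s"
    by blast
  then have "(f ^^ (2 * (m * k))) s = (f ^^ (m * k)) s"
    by (simp add: funpow_mult mult.left_commute)
  moreover have "m * k \<ge> 1" using m(1) k(1) by simp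
  ultimately show ?thesis by blast
qed

text \<open>The generators of \<open>Per G f\<close> are the images \<open>(f ^^ N) s\<close> of those \<open>s \<in> S\<close> with finite orbit. The
  remaining elements of \<open>S\<close> are factors of no periodic point.\<close>

theorem finitely_generated_Per:
  assumes "monoid G" and f: "f \<in> monoid_endomorphisms G"
    and S: "finite S" "S \<subseteq> carrier G" "submonoid_generated G S = carrier G"
    and fin: "\<And>x. x \<in> carrier G \<Longrightarrow> finite (factors G x)"
  shows "finitely_generated_submonoid G (Per G f)"
proof -
  interpret monoid G by fact
  have pow: "f ^^ n \<in> monoid_endomorphisms G" for n
    by (intro funpow_monoid_endomorphism f monoid_axioms)
  define B where "B = {s \<in> S. \<exists>k\<ge>1. (f ^^ (2 * k)) s = (f ^^ k) s}"
  have B: "finite B" "B \<subseteq> carrier G" using S by (auto simp: B_def)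
  have "\<forall>s\<in>B. \<exists>k. k \<ge> 1 \<and> (f ^^ (2 * k)) s = (f ^^ k) s"
    by (auto simp: B_def)
  then obtain k where k: "\<And>s. s \<in> B \<Longrightarrow> k s \<ge> 1 \<and> (f ^^ (2 * k s)) s = (f ^^ k s) s"
    by metis
  define N where "N = (\<Prod>s\<in>B. k s)"
  have N: "N \<ge> 1" unfolding N_def using k by (intro prod_ge_1) auto
  \<comment> \<open>one exponent that is idempotent on all of \<open>B\<close> at once\<close>
  have idem: "(f ^^ (j * N)) s = (f ^^ N) s" if "s \<in> B" "j \<ge> 1" for j s
  proof -
    have "k s dvd N" unfolding N_def using B that by (intro dvd_prodI) auto
    then obtain i where i: "N = i * k s" by (auto simp: dvd_def mult.commute)
    with N have "i \<ge> 1" "j * i \<ge> 1" using that by (auto simp: Suc_le_eq)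
    then show ?thesis
      using funpow_idem_mult[of "k s" f s] k[OF that(1)] by (simp add: i flip: mult.assoc)
  qed
  let ?T = "(f ^^ N) ` B"
  have Tc: "?T \<subseteq> carrier G"
    using pow[of N] B by (auto simp: monoid_endomorphisms_def hom_def)
  have Per: "submonoid (Per G f) G" by (intro submonoid_Per f monoid_axioms)
  have TPer: "?T \<subseteq> Per G f"
  proof
    fix t assume "t \<in> ?T"
    then obtain s where "s \<in> B" "t = (f ^^ N) s" by auto
    then have "(f ^^ N) t = t" using idem[of s 2] by (simp add: mult_2 funpow_add)
    then show "t \<in> Per G f" using N Tc \<open>t \<in> ?T\<close> by (auto simp: Per_def Fix_def)
  qed
  have "Per G f \<subseteq> submonoid_generated G ?T"
  proof
    fix x assume x: "x \<in> Per G f"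
    then obtain m where m: "x \<in> carrier G" "m \<ge> 1" "(f ^^ m) x = x"
      by (auto simp: Per_def Fix_def)
    have "S \<inter> factors G x \<subseteq> B"
      using factor_of_periodic_idem_power[OF monoid_axioms f fin x] m by (auto simp: B_def)
    then have "x \<in> submonoid_generated G B"
      using generated_by_factors[OF monoid_axioms S(2,3)] submonoid_generated_mono m by blast
    \<comment> \<open>\<open>f ^^ (m * N)\<close> fixes \<open>x\<close>, yet acts on \<open>B\<close> like \<open>f ^^ N\<close>, whatever \<open>m\<close> is\<close>
    then have "(f ^^ (m * N)) x \<in> submonoid_generated G ((f ^^ (m * N)) ` B)"
      using image_submonoid_generated[OF monoid_axioms pow B(2)] by blast
    moreover have "(f ^^ (m * N)) ` B = ?T"
      using idem m by (intro image_cong) auto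
    ultimately show "x \<in> submonoid_generated G ?T"
      using funpow_mult_fixed[OF m(3)] by simp
  qed
  then have "submonoid_generated G ?T = Per G f"
    using submonoid_generated_least[OF Per TPer] by blast
  then show ?thesis
    unfolding finitely_generated_submonoid_def using Per TPer B(1) by blast
qed


section \<open>Words acting on reduced words\<close>

text \<open>Right multiplication by a letter in the free group, on reduced words. A reduced word is stored
  with its last letter first, so that multiplication and cancellation both happen at the head of the
  list.\<close>

definition push :: "'a letter list \<Rightarrow> 'a letter \<Rightarrow> 'a letter list" where
  "push s a = (case s of b # s' \<Rightarrow> if b = letter_inv a then s' else a # s | [] \<Rightarrow> [a])"

definition reduced :: "'a letter list \<Rightarrow> bool" where
  "reduced = successively (\<lambda>b c. c \<noteq> letter_inv b)"

abbreviation act :: "'a letter list \<Rightarrow> 'a letter list \<Rightarrow> 'a letter list" where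
  "act \<equiv> foldl push"

text \<open>For \<open>s = []\<close> this is the Munn tree of the word. Allowing every start \<open>s\<close> makes the
  translation \<open>T\<^sub>u \<union> u T\<^sub>v\<close> in the Munn tree of a product a mere change of start.\<close>

primrec visits :: "'a letter list \<Rightarrow> 'a letter list \<Rightarrow> 'a letter list set" where
  "visits s [] = {s}"
| "visits s (a # w) = insert s (visits (push s a) w)"

lemma reduced_Nil [simp]: "reduced []"
  by (simp add: reduced_def)

lemma reduced_Cons: "reduced (a # s) \<longleftrightarrow> (s = [] \<or> hd s \<noteq> letter_inv a) \<and> reduced s"
  by (auto simp: reduced_def successively_Cons)

lemma reduced_push [simp]: "reduced s \<Longrightarrow> reduced (push s a)"
  by (auto simp: push_def reduced_Cons split: list.splits)

lemma reduced_act [simp]: "reduced s \<Longrightarrow> reduced (act s w)"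
  by (induction w arbitrary: s) auto

lemma letter_inv_neq: "letter_inv a \<noteq> a" "a \<noteq> letter_inv a"
  by (cases a; simp)+

lemma push_cancel [simp]: "reduced s \<Longrightarrow> push (push s a) (letter_inv a) = s"
  by (cases s) (auto simp: push_def reduced_Cons letter_inv_neq split: list.splits)

lemma push_cancel' [simp]: "reduced s \<Longrightarrow> push (push s (letter_inv a)) a = s"
  using push_cancel[of s "letter_inv a"] by simp

lemma word_inv_Cons: "word_inv (a # w) = word_inv w @ [letter_inv a]"
  by (simp add: word_inv_def)

lemma act_word_inv [simp]: "reduced s \<Longrightarrow> act (act s w) (word_inv w) = s"
  by (induction w arbitrary: s) (auto simp: word_inv_Cons)

lemma act_word_inv' [simp]: "reduced s \<Longrightarrow> act (act s (word_inv w)) w = s"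
  using act_word_inv[of s "word_inv w"] by simp

lemma act_rev_reduced: "reduced t \<Longrightarrow> act [] (rev t) = t"
  by (induction t) (auto simp: reduced_Cons push_def split: list.splits)

text \<open>A word and its reduced form act in the same way; \<open>rev\<close> turns the stored form back into a word.\<close>

lemma act_rev_act:
  assumes "reduced s"
  shows "act s (rev (act [] w)) = act s w"
proof (induction w rule: rev_induct)
  case (snoc a w)
  show ?case
  proof (cases "\<exists>t. act [] w = letter_inv a # t")
    case True
    then obtain t where t: "act [] w = letter_inv a # t" by auto
    have "act s w = push (act s (rev t)) (letter_inv a)" using snoc t by simp
    then show ?thesis using assms t by (simp add: push_def[of "letter_inv a # t"])
  next
    case False
    then have "act [] (w @ [a]) = a # act [] w"
      by (auto simp: push_def split: list.splits)
    then show ?thesis using snoc by simp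
  qed
qed simp

text \<open>Left translation in the free group is injective. To undo it, start at the inverse of \<open>s\<close>:
  from there \<open>rev s\<close> leads to the unit, and \<open>rev s @ rev t\<close> leads to \<open>t\<close>.\<close>

lemma act_rev_inj:
  assumes s: "reduced s" and t: "reduced t" "reduced t'"
    and eq: "act s (rev t) = act s (rev t')"
  shows "t = t'"
proof -
  let ?r = "act [] (word_inv (rev s))"
  have "act ?r (rev s @ rev q) = act [] (rev q)" for q
    by simp
  moreover have "act ?r (rev s @ rev q) = act ?r (rev (act s (rev q)))" for q
    using act_rev_act[of ?r "rev s @ rev q"] by (simp add: act_rev_reduced s)
  ultimately have "act [] (rev t) = act [] (rev t')"
    using eq by metis
  then show ?thesis using t by (simp add: act_rev_reduced)
qed

lemma visits_append [simp]: "visits s (u @ v) = visits s u \<union> visits (act s u) v"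
  by (induction u arbitrary: s) (auto, (case_tac v; simp)+)

lemma start_in_visits [simp]: "s \<in> visits s w"
  by (cases w) auto

lemma act_in_visits [simp]: "act s w \<in> visits s w"
  by (induction w arbitrary: s) auto

lemma finite_visits [simp]: "finite (visits s w)"
  by (induction w arbitrary: s) auto

lemma visits_word_inv [simp]: "reduced s \<Longrightarrow> visits (act s w) (word_inv w) = visits s w"
  by (induction w arbitrary: s) (auto simp: word_inv_Cons)

lemma reduced_visits: "reduced s \<Longrightarrow> t \<in> visits s w \<Longrightarrow> reduced t"
proof (induction w arbitrary: s)
  case (Cons a w)
  then show ?case using Cons.IH[of "push s a"] by auto
qed simp

text \<open>The path of \<open>w\<close> from \<open>s\<close> is the left translate by \<open>s\<close> of its path from the unit.\<close>

lemma visits_translate: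
  assumes "reduced s" and "t \<in> visits [] w"
  shows "act s (rev t) \<in> visits s w"
  using assms(2)
proof (induction w rule: rev_induct)
  case (snoc a w)
  then show ?case using act_rev_act[OF assms(1), of "w @ [a]"] act_rev_act[OF assms(1), of w]
    by auto
qed simp

lemma push_closed: "s \<in> lists X \<Longrightarrow> a \<in> X \<Longrightarrow> push s a \<in> lists X"
  by (auto simp: push_def split: list.splits)

lemma visits_closed: "s \<in> lists X \<Longrightarrow> w \<in> lists X \<Longrightarrow> visits s w \<subseteq> lists X"
  by (induction w arbitrary: s) (auto simp: push_closed)


section \<open>Word classes in the free inverse monoid\<close>

abbreviation words :: "'a set \<Rightarrow> 'a letter list set" where
  "words A \<equiv> lists (signed_alphabet A)"

abbreviation free_inverse_cong :: "'a set \<Rightarrow> ('a letter list \<times> 'a letter list) set" where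
  "free_inverse_cong A \<equiv>
     congruence_generated (free_monoid (signed_alphabet A)) (free_inverse_relators A)"

definition word_class :: "'a set \<Rightarrow> 'a letter list \<Rightarrow> 'a letter list set" where
  "word_class A w = free_inverse_cong A `` {w}"

lemma set_word_inv [simp]: "set (word_inv w) = letter_inv ` set w"
  by (simp add: word_inv_def)

lemma letter_inv_in_signed_alphabet [simp]:
  "letter_inv a \<in> signed_alphabet A \<longleftrightarrow> a \<in> signed_alphabet A"
  by (cases a) (auto simp: signed_alphabet_def)

lemma word_inv_in_words [simp]: "word_inv w \<in> words A \<longleftrightarrow> w \<in> words A"
  by (simp add: in_lists_conv_set)

lemma rev_in_words [simp]: "rev w \<in> words A \<longleftrightarrow> w \<in> words A"
  by (simp add: in_lists_conv_set)

lemma cong_free_inverse: "monoid_congruence (free_monoid (signed_alphabet A)) (free_inverse_cong A)"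
  by (rule monoid_congruence_generated[OF monoid_free_monoid])
    (use free_inverse_relators_closed in \<open>simp add: free_monoid_def\<close>)

lemma equiv_free_inverse: "equiv (words A) (free_inverse_cong A)"
  using cong_free_inverse[of A] by (simp add: monoid_congruence_def free_monoid_def)

lemma word_class_eq_iff:
  "u \<in> words A \<Longrightarrow> v \<in> words A \<Longrightarrow> word_class A u = word_class A v \<longleftrightarrow> (u, v) \<in> free_inverse_cong A"
  unfolding word_class_def by (rule eq_equiv_class_iff[OF equiv_free_inverse])

lemma carrier_free_inverse_monoid: "carrier (free_inverse_monoid A) = word_class A ` words A"
  by (auto simp: free_inverse_monoid_def quotient_monoid_def quotient_def free_monoid_def word_class_def)

lemma one_free_inverse_monoid: "\<one>\<^bsub>free_inverse_monoid A\<^esub> = word_class A []"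
  by (simp add: free_inverse_monoid_def quotient_monoid_def free_monoid_def word_class_def)

lemma mult_word_class:
  assumes "u \<in> words A" and "v \<in> words A"
  shows "word_class A u \<otimes>\<^bsub>free_inverse_monoid A\<^esub> word_class A v = word_class A (u @ v)"
  using quotient_monoid_mult_class[OF cong_free_inverse[of A], of u v] assms
  by (simp add: free_inverse_monoid_def free_monoid_def word_class_def)

lemma word_class_append_cong:
  assumes "word_class A u = word_class A u'" and "word_class A v = word_class A v'"
    and "u \<in> words A" "u' \<in> words A" "v \<in> words A" "v' \<in> words A"
  shows "word_class A (u @ v) = word_class A (u' @ v')"
  using assms by (metis mult_word_class)

lemma word_class_context:
  assumes "word_class A u = word_class A v"
    and "x \<in> words A" "u \<in> words A" "v \<in> words A" "y \<in> words A"
  shows "word_class A (x @ u @ y) = word_class A (x @ v @ y)"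
  using assms by (intro word_class_append_cong) (auto intro: word_class_append_cong)

lemma relator_word_class:
  assumes "(u, v) \<in> free_inverse_relators A"
  shows "word_class A u = word_class A v"
proof -
  have "(u, v) \<in> free_inverse_cong A"
    using assms by (auto simp: congruence_generated_def)
  moreover have "u \<in> words A" "v \<in> words A"
    using assms free_inverse_relators_closed by blast+
  ultimately show ?thesis by (simp add: word_class_eq_iff)
qed

lemma word_class_inverse:
  assumes "u \<in> words A"
  shows "word_class A (u @ word_inv u @ u) = word_class A u"
  using assms by (intro relator_word_class) (auto simp: free_inverse_relators_def)

lemma word_class_idem_commute:
  assumes "u \<in> words A" and "v \<in> words A"
  shows "word_class A (u @ word_inv u @ v @ word_inv v) = word_class A (v @ word_inv v @ u @ word_inv u)"
  using assms by (intro relator_word_class) (auto simp: free_inverse_relators_def)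

text \<open>Words that agree in endpoint and visited vertices for every start form a congruence, and it
  contains the relators: after \<open>u\<close>, reading \<open>word_inv u\<close> retraces the path and returns to the
  start without meeting a new vertex.\<close>

lemma word_class_invariant:
  assumes eq: "word_class A u = word_class A v" and uv: "u \<in> words A" "v \<in> words A"
    and s: "reduced s"
  shows "act s u = act s v" and "visits s u = visits s v"
proof -
  let ?r = "{(u, v). u \<in> words A \<and> v \<in> words A \<and>
    (\<forall>s. reduced s \<longrightarrow> act s u = act s v \<and> visits s u = visits s v)}"
  have "monoid_congruence (free_monoid (signed_alphabet A)) ?r"
    unfolding monoid_congruence_def
    by (auto simp: free_monoid_def intro!: equivI refl_onI symI transI)
  moreover have "free_inverse_relators A \<subseteq> ?r"
    by (auto simp: free_inverse_relators_def)
  ultimately have "free_inverse_cong A \<subseteq> ?r"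
    unfolding congruence_generated_def by blast
  then show "act s u = act s v" "visits s u = visits s v"
    using word_class_eq_iff[OF uv] eq s by blast+
qed


section \<open>Normal forms and finiteness of factor sets\<close>

text \<open>The product of the idempotents \<open>p p\<^sup>-\<^sup>1\<close> over a list of words \<open>p\<close>, stored in reverse as
  above. Up to the congruence, it depends only on the set of entries.\<close>

definition idem_word :: "'a letter list list \<Rightarrow> 'a letter list" where
  "idem_word L = concat (map (\<lambda>t. rev t @ word_inv (rev t)) L)"

lemma idem_word_simps [simp]:
  "idem_word [] = []"
  "idem_word (t # L) = rev t @ word_inv (rev t) @ idem_word L"
  by (simp_all add: idem_word_def)

lemma idem_word_in_words [simp]: "set L \<subseteq> words A \<Longrightarrow> idem_word L \<in> words A"
  by (induction L) simp_all

lemma idem_word_commute: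
  assumes "set L \<subseteq> words A" and p: "p \<in> words A"
  shows "word_class A (idem_word L @ p @ word_inv p) = word_class A (p @ word_inv p @ idem_word L)"
  using assms(1)
proof (induction L)
  case (Cons t L)
  let ?t = "rev t" and ?e = "idem_word L"
  have c: "?t \<in> words A" "?e \<in> words A" "word_inv ?t \<in> words A" "word_inv p \<in> words A"
    using Cons.prems p by simp_all
  have "word_class A ((?t @ word_inv ?t) @ (?e @ p @ word_inv p) @ []) =
      word_class A ((?t @ word_inv ?t) @ (p @ word_inv p @ ?e) @ [])"
    using Cons c p by (intro word_class_context) simp_all
  also have "\<dots> = word_class A ([] @ (?t @ word_inv ?t @ p @ word_inv p) @ ?e)" by simp
  also have "\<dots> = word_class A ([] @ (p @ word_inv p @ ?t @ word_inv ?t) @ ?e)"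
    using c p by (intro word_class_context word_class_idem_commute) simp_all
  finally show ?case by simp
qed simp

lemma idem_word_absorb:
  assumes "set L \<subseteq> words A" and "t \<in> set L"
  shows "word_class A (idem_word L @ rev t @ word_inv (rev t)) = word_class A (idem_word L)"
  using assms
proof (induction L)
  case (Cons q L)
  let ?e = "idem_word L" and ?p = "rev t"
  have c: "?e \<in> words A" "rev q \<in> words A" "word_inv (rev q) \<in> words A"
    "?p \<in> words A" "word_inv ?p \<in> words A"
    using Cons.prems by auto
  show ?case
  proof (cases "t \<in> set L")
    case True
    then have "word_class A ((rev q @ word_inv (rev q)) @ (?e @ ?p @ word_inv ?p) @ []) =
        word_class A ((rev q @ word_inv (rev q)) @ ?e @ [])"
      using Cons c by (intro word_class_context) simp_all
    then show ?thesis by simp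
  next
    case False
    then have q: "t = q" using Cons by simp
    have "word_class A ((?p @ word_inv ?p) @ (?e @ ?p @ word_inv ?p) @ []) =
        word_class A ((?p @ word_inv ?p) @ (?p @ word_inv ?p @ ?e) @ [])"
      using Cons c by (intro word_class_context idem_word_commute) simp_all
    also have "\<dots> = word_class A ([] @ (?p @ word_inv ?p @ ?p) @ word_inv ?p @ ?e)" by simp
    also have "\<dots> = word_class A ([] @ ?p @ word_inv ?p @ ?e)"
      using c by (intro word_class_context word_class_inverse) simp_all
    finally show ?thesis by (simp add: q)
  qed
qed simp

lemma idem_word_insert:
  assumes L: "set L \<subseteq> words A" and t: "t \<in> words A"
  shows "word_class A (idem_word (List.insert t L)) = word_class A (idem_word L @ rev t @ word_inv (rev t))"
proof (cases "t \<in> set L")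
  case True
  then show ?thesis using idem_word_absorb[OF L] by simp
next
  case False
  then show ?thesis using idem_word_commute[OF L, of "rev t"] t by simp
qed

text \<open>The last factor \<open>p\<close> may be replaced by \<open>p p\<^sup>-\<^sup>1 p\<close>, which adds the vertex \<open>p\<close> to the list.\<close>

lemma idem_word_insert_append:
  assumes L: "set L \<subseteq> words A" and t: "t \<in> words A"
  shows "word_class A (idem_word (List.insert t L) @ rev t) = word_class A (idem_word L @ rev t)"
proof -
  let ?e = "idem_word L" and ?p = "rev t"
  have c: "?e \<in> words A" "?p \<in> words A" "word_inv ?p \<in> words A"
    "idem_word (List.insert t L) \<in> words A"
    using L t by simp_all
  have "word_class A (idem_word (List.insert t L) @ ?p) = word_class A ((?e @ ?p @ word_inv ?p) @ ?p)"
    using c idem_word_insert[OF L t]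
    by (intro word_class_append_cong) simp_all
  also have "\<dots> = word_class A (?e @ (?p @ word_inv ?p @ ?p) @ [])" by simp
  also have "\<dots> = word_class A (?e @ ?p @ [])"
    using c by (intro word_class_context word_class_inverse) simp_all
  finally show ?thesis by simp
qed

text \<open>Free cancellation \<open>q a a\<^sup>-\<^sup>1 \<mapsto> q\<close> is not valid in the free inverse monoid, but it becomes valid
  behind an idempotent that records the vertex \<open>q a\<close>: writing \<open>q\<close> as \<open>q q\<^sup>-\<^sup>1 q\<close> and commuting the
  idempotents \<open>q\<^sup>-\<^sup>1 q\<close> and \<open>a a\<^sup>-\<^sup>1\<close> yields \<open>(q a)(q a)\<^sup>-\<^sup>1 q\<close>, whose idempotent part is absorbed.\<close>

lemma idem_word_backtrack:
  assumes L: "set L \<subseteq> words A" and t: "a # t \<in> set L"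
  shows "word_class A (idem_word L @ rev (a # t) @ [letter_inv a]) = word_class A (idem_word L @ rev t)"
proof -
  let ?e = "idem_word L" and ?q = "rev t"
  have at: "[a] \<in> words A" "t \<in> words A" using L t by auto
  then have c: "?e \<in> words A" "?q \<in> words A" "word_inv ?q \<in> words A" "word_inv [a] \<in> words A"
    using L by simp_all
  have "word_class A (?e @ rev (a # t) @ [letter_inv a]) =
      word_class A (?e @ ?q @ ([a] @ word_inv [a]))"
    by (simp add: word_inv_def)
  also have "\<dots> = word_class A (?e @ (?q @ word_inv ?q @ ?q) @ ([a] @ word_inv [a]))"
    using c at by (intro word_class_context word_class_inverse[symmetric]) simp_all
  also have "\<dots> = word_class A ((?e @ ?q) @ (word_inv ?q @ word_inv (word_inv ?q) @ [a] @ word_inv [a]) @ [])"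
    by simp
  also have "\<dots> = word_class A ((?e @ ?q) @ ([a] @ word_inv [a] @ word_inv ?q @ word_inv (word_inv ?q)) @ [])"
    using c at by (intro word_class_context word_class_idem_commute) simp_all
  also have "\<dots> = word_class A ([] @ (?e @ rev (a # t) @ word_inv (rev (a # t))) @ ?q)"
    by simp
  also have "\<dots> = word_class A ([] @ ?e @ ?q)"
    using c at idem_word_absorb[OF L t]
    by (intro word_class_context) simp_all
  finally show ?thesis by simp
qed

text \<open>The half of Munn's theorem that bounds the number of classes. Reading one more letter either
  extends the reduced word or backtracks; in both cases the vertex reached is then added to the list.
  Distinctness of \<open>L\<close> is what leaves finitely many lists for a given finite set of vertices.\<close>

theorem word_class_normal_form:
  assumes "w \<in> words A"
  shows "\<exists>L. distinct L \<and> set L = visits [] w \<and>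
    word_class A w = word_class A (idem_word L @ rev (act [] w))"
  using assms
proof (induction w rule: rev_induct)
  case Nil
  show ?case by (intro exI[of _ "[[]]"]) simp
next
  case (snoc a w)
  have aw: "[a] \<in> words A" "w \<in> words A" using snoc.prems by auto
  let ?t = "act [] w"
  obtain L where L: "distinct L" "set L = visits [] w"
      "word_class A w = word_class A (idem_word L @ rev ?t)"
    using snoc.IH aw by blast
  have Lc: "set L \<subseteq> words A" using L(2) visits_closed[of "[]" "signed_alphabet A" w] aw by simp
  have tL: "?t \<in> set L" using L by simp
  have tc: "?t \<in> words A" using tL Lc by blast
  have pc: "push ?t a \<in> words A" using push_closed[OF tc] aw by simp
  have "word_class A (w @ [a]) = word_class A ((idem_word L @ rev ?t) @ [a])"
    using L(3) Lc aw tc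
    by (intro word_class_append_cong) simp_all
  also have "\<dots> = word_class A (idem_word L @ rev (push ?t a))"
  proof (cases "\<exists>t'. ?t = letter_inv a # t'")
    case True
    then obtain t' where t': "?t = letter_inv a # t'" by auto
    with idem_word_backtrack[of L A "letter_inv a" t'] Lc tL show ?thesis
      by (simp add: push_def)
  next
    case False
    then have "push ?t a = a # ?t" by (auto simp: push_def split: list.splits)
    then show ?thesis by simp
  qed
  also have "\<dots> = word_class A (idem_word (List.insert (push ?t a) L) @ rev (push ?t a))"
    using idem_word_insert_append[OF Lc pc] by simp
  finally have "word_class A (w @ [a]) =
    word_class A (idem_word (List.insert (push ?t a) L) @ rev (act [] (w @ [a])))" by simp
  moreover have "set (List.insert (push ?t a) L) = visits [] (w @ [a])"
    using L(2) by auto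
  ultimately show ?case using L(1) distinct_insert by metis
qed

lemma finite_word_classes_visiting:
  assumes "finite P"
  shows "finite {word_class A w | w. w \<in> words A \<and> visits [] w \<subseteq> P}"
proof (rule finite_subset)
  show "{word_class A w | w. w \<in> words A \<and> visits [] w \<subseteq> P} \<subseteq>
    (\<lambda>(L, t). word_class A (idem_word L @ rev t)) ` ({L. set L \<subseteq> P \<and> distinct L} \<times> P)"
  proof
    fix x assume "x \<in> {word_class A w | w. w \<in> words A \<and> visits [] w \<subseteq> P}"
    then obtain w where w: "x = word_class A w" "w \<in> words A" "visits [] w \<subseteq> P" by auto
    then obtain L where "distinct L" "set L = visits [] w" "x = word_class A (idem_word L @ rev (act [] w))"
      using word_class_normal_form by metis
    moreover have "act [] w \<in> P" using w act_in_visits by blast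
    ultimately show "x \<in> (\<lambda>(L, t). word_class A (idem_word L @ rev t)) `
        ({L. set L \<subseteq> P \<and> distinct L} \<times> P)"
      using w by (auto intro!: image_eqI[of _ _ "(L, act [] w)"])
  qed
  show "finite ((\<lambda>(L, t). word_class A (idem_word L @ rev t)) ` ({L. set L \<subseteq> P \<and> distinct L} \<times> P))"
    using finite_subset_distinct[OF assms] assms by simp
qed

text \<open>If \<open>w\<close> and \<open>u @ v @ z\<close> represent the same element, then the path of \<open>v\<close> from the endpoint \<open>s\<close> of \<open>u\<close>
  stays in the finite set \<open>P\<close> of vertices visited by \<open>w\<close>. Hence the Munn tree of \<open>v\<close> lies in the
  translate of \<open>P\<close> by the inverse of \<open>s\<close>. There are finitely many translates, since \<open>s \<in> P\<close>.\<close>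

theorem finite_factors_free_inverse_monoid:
  assumes "x \<in> carrier (free_inverse_monoid A)"
  shows "finite (factors (free_inverse_monoid A) x)"
proof -
  obtain w where w: "w \<in> words A" "x = word_class A w"
    using assms by (auto simp: carrier_free_inverse_monoid)
  let ?P = "visits [] w"
  let ?Q = "\<lambda>s. {t. reduced t \<and> act s (rev t) \<in> ?P}"
  let ?F = "\<lambda>s. {word_class A v | v. v \<in> words A \<and> visits [] v \<subseteq> ?Q s}"
  have red: "reduced s" if "s \<in> ?P" for s using reduced_visits that by (metis reduced_Nil)
  have "finite (?Q s)" if "s \<in> ?P" for s
  proof (rule finite_imageD)
    show "finite ((\<lambda>t. act s (rev t)) ` ?Q s)"
      by (rule finite_subset[of _ ?P]) auto
    show "inj_on (\<lambda>t. act s (rev t)) (?Q s)"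
      using act_rev_inj[OF red[OF that]] by (auto intro!: inj_onI)
  qed
  then have fin: "finite (\<Union>s\<in>?P. ?F s)"
    using finite_word_classes_visiting[of "?Q s" A for s] by (intro finite_UN_I) auto
  have "factors (free_inverse_monoid A) x \<subseteq> (\<Union>s\<in>?P. ?F s)"
  proof
    fix y assume "y \<in> factors (free_inverse_monoid A) x"
    then obtain u v z where uvz: "u \<in> words A" "v \<in> words A" "z \<in> words A" "y = word_class A v"
      and "word_class A w = word_class A u \<otimes>\<^bsub>free_inverse_monoid A\<^esub> word_class A v
        \<otimes>\<^bsub>free_inverse_monoid A\<^esub> word_class A z"
      using w(2) by (auto simp: factors_def carrier_free_inverse_monoid)
    then have "word_class A w = word_class A (u @ v @ z)"
      by (simp add: mult_word_class)
    then have P: "?P = visits [] (u @ v @ z)"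
      using w uvz by (intro word_class_invariant(2)) auto
    let ?s = "act [] u"
    have s: "?s \<in> ?P" unfolding P by simp
    have "visits [] v \<subseteq> ?Q ?s"
      using visits_translate[OF red[OF s]] reduced_visits[of "[]" _ v] unfolding P by auto
    then show "y \<in> (\<Union>s\<in>?P. ?F s)" using s uvz by blast
  qed
  then show ?thesis using fin finite_subset by blast
qed

lemma letters_generate_free_inverse_monoid:
  "submonoid_generated (free_inverse_monoid A) ((\<lambda>a. word_class A [a]) ` signed_alphabet A) =
     carrier (free_inverse_monoid A)" (is "submonoid_generated ?M ?S = _")
proof
  have S: "?S \<subseteq> carrier ?M" by (auto simp: carrier_free_inverse_monoid)
  interpret H: submonoid "submonoid_generated ?M ?S" ?M
    by (intro submonoid_submonoid_generated monoid_free_inverse_monoid S)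
  show "submonoid_generated ?M ?S \<subseteq> carrier ?M" by (rule H.subset)
  have "word_class A w \<in> submonoid_generated ?M ?S" if "w \<in> words A" for w
    using that
  proof (induction w)
    case Nil
    show ?case using H.one_closed by (simp add: one_free_inverse_monoid)
  next
    case (Cons a w)
    have "word_class A [a] \<in> submonoid_generated ?M ?S"
      using Cons submonoid_generated_incl[of ?S ?M] by auto
    then have "word_class A [a] \<otimes>\<^bsub>?M\<^esub> word_class A w \<in> submonoid_generated ?M ?S"
      using Cons by (intro H.m_closed) auto
    then show ?case using Cons by (simp add: mult_word_class)
  qed
  then show "carrier ?M \<subseteq> submonoid_generated ?M ?S"
    by (auto simp: carrier_free_inverse_monoid)
qed

theorem theorem3p8:
  fixes A :: "'a set" and \<phi> :: "'a letter list set \<Rightarrow> 'a letter list set"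
  assumes "finite A"
    and "\<phi> \<in> monoid_endomorphisms (free_inverse_monoid A)"
  shows "finitely_generated_submonoid (free_inverse_monoid A) (Per (free_inverse_monoid A) \<phi>)"
proof (rule finitely_generated_Per)
  show "finite ((\<lambda>a. word_class A [a]) ` signed_alphabet A)"
    using assms(1) by (simp add: signed_alphabet_def)
  show "(\<lambda>a. word_class A [a]) ` signed_alphabet A \<subseteq> carrier (free_inverse_monoid A)"
    by (auto simp: carrier_free_inverse_monoid)
qed (fact monoid_free_inverse_monoid assms(2) letters_generate_free_inverse_monoid
      finite_factors_free_inverse_monoid)+

end
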